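(* Let $d_1,d_2\ge1$, let $S_1\subseteq\mathbb{N}^{d_1}$, $S_2\subseteq\mathbb{N}^{d_2}$ be good semigroups (not necessarily local), and let $E_1\subsetneq S_1$, $E_2\subsetneq S_2$ be proper good ideals. Put $S=S_1\times S_2\subseteq\mathbb{N}^{d_1+d_2}$, $E=E_1\times E_2$ (a good ideal of $S$) and $A=S\setminus E$, and let $\lambda_1:S_1\to\mathbb N$, $\lambda_2:S_2\to\mathbb N$ be the level functions of $S_1$, $S_2$ with respect to $S_1\setminus E_1$ and $S_2\setminus E_2$. Then for every $(\boldsymbol\alpha^{(1)},\boldsymbol\alpha^{(2)})\in A$, the level of $A$ containing $(\boldsymbol\alpha^{(1)},\boldsymbol\alpha^{(2)})$ is $A_k$ with $$k=\lambda_1(\boldsymbol\alpha^{(1)})+\lambda_2(\boldsymbol\alpha^{(2)})-1.$$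
   Context: Notation: on $\mathbb{Z}^d$, $\le$ is componentwise, $\boldsymbol\alpha<\boldsymbol\beta$ means $\le$ and $\ne$, $\boldsymbol\alpha\ll\boldsymbol\beta$ means $\alpha_i<\beta_i$ for all $i$, $\boldsymbol\alpha\le\le\boldsymbol\beta$ means $\boldsymbol\alpha=\boldsymbol\beta$ or $\boldsymbol\alpha\ll\boldsymbol\beta$, $\boldsymbol\alpha\wedge\boldsymbol\beta$ componentwise minimum, $I=\{1,\dots,d\}$, $\Delta^T_F(\boldsymbol\alpha)=\{\boldsymbol\beta\in T:\beta_i=\alpha_i\ (i\in F),\ \beta_j>\alpha_j\ (j\notin F)\}$. A good semigroup is a submonoid $S$ of $(\mathbb{N}^d,+)$ with (G1) closure under $\wedge$; (G2) if $\boldsymbol\alpha\neq\boldsymbol\beta\in S$ with $\alpha_i=\beta_i$, there is $\boldsymbol\epsilon\in S$ with $\epsilon_i>\alpha_i$, $\epsilon_j\ge\min\{\alpha_j,\beta_j\}$ for $j\ne i$, with equality if $\alpha_j\ne\beta_j$; (G3) $\boldsymbol c+\mathbb N^d\subseteq S$ for some $\boldsymbol c$. A good ideal is $E\subseteq S$ with $E+S\subseteq E$ satisfying (G1)–(G3). For $d=1$ good semigroups are numerical semigroups. Levels of $A=S\setminus E$ ($E$ a proper good ideal): $\boldsymbol\alpha\in B$ is a complete infimum of $\boldsymbol\beta^{(1)},\dots,\boldsymbol\beta^{(r)}\in B$ ($r\ge2$) if $\boldsymbol\beta^{(j)}\in\Delta^S_{F_j}(\boldsymbol\alpha)$ with $\emptyset\ne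 F_j\subsetneq I$, pairwise infima equal $\boldsymbol\alpha$, and $\bigcap F_j=\emptyset$. $B^{(1)}$ = maximal elements of $A$ for $\le\le$, $C^{(1)}$ = those that are complete infima of $r$ elements of $B^{(1)}$ ($1<r\le d$), $D^{(1)}=B^{(1)}\setminus C^{(1)}$; inductively $B^{(i)}$ = maximal elements for $\le\le$ of $A\setminus\bigcup_{j<i}D^{(j)}$, and $C^{(i)},D^{(i)}$ likewise; $A=\bigsqcup_{i=1}^ND^{(i)}$ and the levels are $A_i=D^{(N+1-i)}$. (For $d=1$, $A=\{w_1<\dots<w_N\}$ is finite and $A_i=\{w_i\}$.) Level function: for a good semigroup $T$ and $A=T\setminus E$ with levels $A_1,\dots,A_N$, $\lambda:T\to\{1,\dots,N+1\}$ is $\lambda(\boldsymbol\alpha)=i$ if $\boldsymbol\alpha\in A_i$, and $\lambda(\boldsymbol\alpha)=1+\max\{i:\boldsymbol\alpha>\boldsymbol\theta\text{ for some }\boldsymbol\theta\in A_i\}$ if $\boldsymbol\alpha\notin A$. *)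

theory Defs
  imports Main
begin

text \<open>Points of N^d are represented as lists of naturals of length d;
  coordinates are indexed 0..d-1 (the paper's I = {1..d}).\<close>

definition vecs :: "nat \<Rightarrow> nat list set" where
  "vecs d = {v. length v = d}"

definition vadd :: "nat list \<Rightarrow> nat list \<Rightarrow> nat list" where
  "vadd a b = map2 (+) a b"

definition vmeet :: "nat list \<Rightarrow> nat list \<Rightarrow> nat list" where
  "vmeet a b = map2 min a b"

definition vle :: "nat list \<Rightarrow> nat list \<Rightarrow> bool" where
  "vle a b \<longleftrightarrow> length a = length b \<and> (\<forall>i<length a. a ! i \<le> b ! i)"

definition vlt :: "nat list \<Rightarrow> nat list \<Rightarrow> bool" where
  "vlt a b \<longleftrightarrow> vle a b \<and> a \<noteq> b"

definition vll :: "nat list \<Rightarrow> nat list \<Rightarrow> bool" where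
  "vll a b \<longleftrightarrow> length a = length b \<and> (\<forall>i<length a. a ! i < b ! i)"

definition vlele :: "nat list \<Rightarrow> nat list \<Rightarrow> bool" where
  "vlele a b \<longleftrightarrow> a = b \<or> vll a b"

definition good_axioms :: "nat \<Rightarrow> nat list set \<Rightarrow> bool" where
  "good_axioms d X \<longleftrightarrow>
     X \<subseteq> vecs d \<and>
     (\<forall>a\<in>X. \<forall>b\<in>X. vmeet a b \<in> X) \<and>
     (\<forall>a\<in>X. \<forall>b\<in>X. \<forall>i<d. a \<noteq> b \<and> a ! i = b ! i \<longrightarrow>
        (\<exists>e\<in>X. e ! i > a ! i \<and>
           (\<forall>j<d. j \<noteq> i \<longrightarrow> e ! j \<ge> min (a ! j) (b ! j) \<and>
                 (a ! j \<noteq> b ! j \<longrightarrow> e ! j = min (a ! j) (b ! j))))) \<and>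
     (\<exists>c\<in>vecs d. \<forall>v\<in>vecs d. vle c v \<longrightarrow> v \<in> X)"

definition good_semigroup :: "nat \<Rightarrow> nat list set \<Rightarrow> bool" where
  "good_semigroup d S \<longleftrightarrow> good_axioms d S \<and> replicate d 0 \<in> S \<and>
     (\<forall>a\<in>S. \<forall>b\<in>S. vadd a b \<in> S)"

definition good_ideal :: "nat \<Rightarrow> nat list set \<Rightarrow> nat list set \<Rightarrow> bool" where
  "good_ideal d S E \<longleftrightarrow> E \<subseteq> S \<and> (\<forall>e\<in>E. \<forall>s\<in>S. vadd e s \<in> E) \<and> good_axioms d E"

definition prodset :: "nat list set \<Rightarrow> nat list set \<Rightarrow> nat list set" where
  "prodset X Y = {a @ b | a b. a \<in> X \<and> b \<in> Y}"

definition maxl :: "nat list set \<Rightarrow> nat list set" where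
  "maxl R = {a \<in> R. \<forall>b\<in>R. vlele a b \<longrightarrow> b = a}"

text \<open>\<alpha> is a complete infimum of r elements of B, 1 < r \<le> d.  The sets
  F_j = {i. \<beta>^(j)_i = \<alpha>_i} are determined by the \<beta>^(j); pairwise
  infima equal \<alpha> forces the \<beta>^(j) to be distinct, so they form a set.\<close>
definition complete_inf :: "nat \<Rightarrow> nat list set \<Rightarrow> nat list \<Rightarrow> bool" where
  "complete_inf d B a \<longleftrightarrow> a \<in> B \<and>
     (\<exists>Bs\<subseteq>B. finite Bs \<and> 2 \<le> card Bs \<and> card Bs \<le> d \<and>
        (\<forall>b\<in>Bs. (\<exists>i<d. b ! i = a ! i) \<and> (\<exists>j<d. b ! j \<noteq> a ! j) \<and>
                  (\<forall>j<d. b ! j \<noteq> a ! j \<longrightarrow> b ! j > a ! j)) \<and>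
        (\<forall>b\<in>Bs. \<forall>c\<in>Bs. b \<noteq> c \<longrightarrow> vmeet b c = a) \<and>
        (\<forall>i<d. \<exists>b\<in>Bs. b ! i \<noteq> a ! i))"

definition Dstep :: "nat \<Rightarrow> nat list set \<Rightarrow> nat list set" where
  "Dstep d R = maxl R - {a. complete_inf d (maxl R) a}"

text \<open>remaining d A n = A minus D^(1),...,D^(n); so D^(n+1) = Dstep d (remaining d A n).\<close>
primrec remaining :: "nat \<Rightarrow> nat list set \<Rightarrow> nat \<Rightarrow> nat list set" where
  "remaining d A 0 = A"
| "remaining d A (Suc n) = remaining d A n - Dstep d (remaining d A n)"

definition nlevels :: "nat \<Rightarrow> nat list set \<Rightarrow> nat" where
  "nlevels d A = (LEAST n. remaining d A n = {})"

text \<open>Level A_k = D^(N+1-k), k = 1..N.\<close>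
definition levelset :: "nat \<Rightarrow> nat list set \<Rightarrow> nat \<Rightarrow> nat list set" where
  "levelset d A k = Dstep d (remaining d A (nlevels d A - k))"

definition level_of :: "nat \<Rightarrow> nat list set \<Rightarrow> nat list \<Rightarrow> nat" where
  "level_of d A a = (THE k. 1 \<le> k \<and> k \<le> nlevels d A \<and> a \<in> levelset d A k)"

text \<open>Level function \<lambda> (on the ambient good semigroup T, where A = T - E);
  max of the empty set is taken as 0, so \<lambda> = 1 then.\<close>
definition level_fun :: "nat \<Rightarrow> nat list set \<Rightarrow> nat list \<Rightarrow> nat" where
  "level_fun d A a = (if a \<in> A then level_of d A a
     else 1 + Max ({0} \<union> {i. 1 \<le> i \<and> i \<le> nlevels d A \<and> (\<exists>t\<in>levelset d A i. vlt t a)}))"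

end

theory Submission
  imports Defs
begin

text \<open>For a point \<open>p\<close> let \<open>has X i p\<close> say that some \<open>s \<in> X\<close> satisfies \<open>p \<le> s\<close> and
  \<open>s\<^sub>i = p\<^sub>i\<close>. On a lattice path from \<open>0\<close> to \<open>p\<close> count those unit steps \<open>q \<rightarrow> q + e\<^sub>i\<close> for
  which \<open>has S i q\<close> holds but \<open>has E i q\<close> fails. By (G2) this number \<open>g p\<close> does not depend
  on the path; for value semigroups it is the length of \<open>R / (I + R(p))\<close>. The
  level of \<open>a \<in> S - E\<close> is \<open>1 + g a\<close>, and \<open>1 + g\<close> is the level function on all of \<open>S\<close>.
  Since paths in a product can be run through one factor after the other, \<open>g\<close> is additive on
  products, which is the claim.

  For the levels, one peels off \<open>{a. g a = m}\<close> from \<open>{a. g a \<le> m}\<close>. A point \<open>a\<close> lies in \<open>E\<close> as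
  soon as \<open>has E i a\<close> for all \<open>i\<close>, so no element with \<open>g a = m\<close> is dominated by, or a complete
  infimum of, elements with \<open>g \<le> m\<close>. Conversely, if \<open>g a < m\<close>, some \<open>c \<in> S - E\<close> above \<open>a\<close> has
  \<open>g c = g a + 1\<close>; unless \<open>a \<lless> c\<close>, the point \<open>a\<close> is the complete infimum of \<open>c\<close> and of the
  least elements of \<open>S\<close> above \<open>a + e\<^sub>k\<close>, for those \<open>k\<close> with \<open>c\<^sub>k = a\<^sub>k\<close>.\<close>

section \<open>Lattice paths\<close>

definition up :: "nat \<Rightarrow> nat list \<Rightarrow> nat list" where
  "up i p = p[i := Suc (p ! i)]"

definition down :: "nat \<Rightarrow> nat list \<Rightarrow> nat list" where
  "down i p = p[i := p ! i - 1]"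

lemma length_up [simp]: "length (up i p) = length p"
  by (simp add: up_def)

lemma length_down [simp]: "length (down i p) = length p"
  by (simp add: down_def)

lemma nth_up: "i < length p \<Longrightarrow> up i p ! j = (if j = i then Suc (p ! i) else p ! j)"
  by (simp add: up_def nth_list_update)

lemma nth_down: "i < length p \<Longrightarrow> down i p ! j = (if j = i then p ! i - 1 else p ! j)"
  by (simp add: down_def nth_list_update)

lemma down_up [simp]: "down i (up i p) = p"
  by (cases "i < length p") (simp_all add: up_def down_def list_update_beyond)

lemma up_down: "i < length p \<Longrightarrow> 0 < p ! i \<Longrightarrow> up i (down i p) = p"
  by (simp add: up_def down_def)

lemma down_commute: "i \<noteq> j \<Longrightarrow> down i (down j p) = down j (down i p)"
  by (simp add: down_def list_update_swap)

lemma sum_list_up: "i < length p \<Longrightarrow> sum_list (up i p) = Suc (sum_list p)"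
  by (simp add: up_def sum_list_update member_le_sum_list)

lemma sum_list_down: "i < length p \<Longrightarrow> 0 < p ! i \<Longrightarrow> sum_list (down i p) < sum_list p"
  using sum_list_up[of i "down i p"] by (simp add: up_down)

lemma vle_refl [simp]: "vle p p"
  by (simp add: vle_def)

lemma vle_trans: "vle p q \<Longrightarrow> vle q r \<Longrightarrow> vle p r"
  unfolding vle_def by (metis (no_types) order_trans)

lemma vle_antisym: "vle p q \<Longrightarrow> vle q p \<Longrightarrow> p = q"
  by (rule nth_equalityI) (simp_all add: vle_def antisym)

lemma vle_up: "vle p (up i p)"
proof (cases "i < length p")
  case False
  then show ?thesis by (simp add: up_def list_update_beyond)
qed (auto simp: vle_def nth_up)

lemma vle_up_iff:
  "i < length p \<Longrightarrow> vle (up i p) q \<longleftrightarrow> vle p q \<and> p ! i < q ! i"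
proof -
  assume i: "i < length p"
  have "(\<forall>j<length p. up i p ! j \<le> q ! j) \<longleftrightarrow> (\<forall>j<length p. p ! j \<le> q ! j) \<and> p ! i < q ! i"
    using i by (simp add: nth_up) (metis Suc_le_eq less_imp_le)
  then show ?thesis by (auto simp: vle_def)
qed

lemma vle_sum_list: "vle p q \<Longrightarrow> sum_list p \<le> sum_list q"
  unfolding vle_def by (auto simp: sum_list_sum_nth intro!: sum_mono)

lemma vle_replicate_0: "length p = d \<Longrightarrow> vle (replicate d 0) p"
  by (simp add: vle_def)

lemma vle_obtain_less:
  assumes "vle p q" "p \<noteq> q"
  obtains i where "i < length p" "p ! i < q ! i"
proof -
  have "\<exists>i<length p. p ! i \<noteq> q ! i"
    using assms nth_equalityI[of p q] by (auto simp: vle_def)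
  then show thesis using that assms by (auto simp: vle_def le_neq_implies_less)
qed

text \<open>Induction along some lattice path from \<open>p\<close> to \<open>c\<close>: the step
  case may choose its direction \<open>i\<close>, and each unit step shrinks the gap between the
  coordinate sums.\<close>

lemma climb [consumes 1, case_names base step]:
  assumes "vle p c" "P p"
    and step: "\<And>q. vle p q \<Longrightarrow> vle q c \<Longrightarrow> q \<noteq> c \<Longrightarrow> P q
      \<Longrightarrow> \<exists>i<length q. q ! i < c ! i \<and> P (up i q)"
  shows "P c"
proof -
  have "vle p q \<Longrightarrow> vle q c \<Longrightarrow> P q \<Longrightarrow> P c" for q
  proof (induction "sum_list c - sum_list q" arbitrary: q rule: less_induct)
    case less
    show ?case
    proof (cases "q = c")
      case False
      then obtain i where i: "i < length q" "q ! i < c ! i" "P (up i q)"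
        using step less.prems by blast
      have "vle (up i q) c" using i less.prems by (simp add: vle_up_iff)
      moreover from this have "sum_list (up i q) \<le> sum_list c" by (rule vle_sum_list)
      ultimately show ?thesis
        using less.hyps[of "up i q"] less.prems i sum_list_up[of i q] vle_up vle_trans
        by (metis Suc_le_eq diff_less_mono2 lessI)
    qed (use less in simp)
  qed
  from this[OF vle_refl assms(1,2)] show ?thesis .
qed

text \<open>One path is fixed, always lowering the first nonzero coordinate, so that the sum is
  defined for arbitrary weights; independence of the path is \<open>pot_down\<close>.\<close>

function pot :: "(nat \<Rightarrow> nat list \<Rightarrow> nat) \<Rightarrow> nat list \<Rightarrow> nat" where
  "pot w p = (if \<exists>i<length p. 0 < p ! i
     then let i = (LEAST i. i < length p \<and> 0 < p ! i); q = down i p in pot w q + w i q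
     else 0)"
  by auto
termination
proof (relation "measure (\<lambda>(w, p). sum_list p)")
  fix w :: "nat \<Rightarrow> nat list \<Rightarrow> nat" and p :: "nat list" and i q
  assume *: "\<exists>i<length p. 0 < p ! i"
    and i: "i = (LEAST i. i < length p \<and> 0 < p ! i)" and q: "q = down i p"
  show "((w, q), w, p) \<in> measure (\<lambda>(w, p). sum_list p)"
    using LeastI_ex[OF *[folded Bex_def]] * sum_list_down[of i p] unfolding i q
    by (metis (mono_tags, lifting) LeastI_ex case_prod_conv in_measure)
qed simp

declare pot.simps [simp del]

lemma pot_zero [simp]: "pot w (replicate d 0) = 0"
  by (subst pot.simps) auto

text \<open>A discrete Poincare lemma: by \<open>square\<close> the two routes around every unit
  square weigh the same, so any last step may replace the one chosen by \<open>pot\<close>.\<close>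

lemma pot_down:
  assumes square: "\<And>q i j. length q = d \<Longrightarrow> i < d \<Longrightarrow> j < d \<Longrightarrow> i \<noteq> j \<Longrightarrow>
      w i q + w j (up i q) = w j q + w i (up j q)"
    and "length p = d" "j < d" "0 < p ! j"
  shows "pot w p = pot w (down j p) + w j (down j p)"
  using assms(2-)
proof (induction "sum_list p" arbitrary: p j rule: less_induct)
  case less
  define i where "i = (LEAST i. i < length p \<and> 0 < p ! i)"
  have i: "i < d" "0 < p ! i"
    using LeastI[of "\<lambda>i. i < length p \<and> 0 < p ! i" j] less.prems unfolding i_def by auto
  have eq: "pot w p = pot w (down i p) + w i (down i p)"
    using less.prems by (subst pot.simps) (auto simp: i_def Let_def)
  show ?case
  proof (cases "i = j")
    case False
    \<comment> \<open>\<open>q\<close> is the corner opposite to \<open>p\<close> of the unit square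
      in directions \<open>i\<close> and \<open>j\<close>. The induction hypothesis at the two
      middle corners takes both routes through \<open>q\<close>.\<close>
    define q where "q = down j (down i p)"
    have "pot w (down i p) = pot w q + w j q"
      unfolding q_def using less i False sum_list_down by (simp add: nth_down)
    moreover have "pot w (down j p) = pot w q + w i q"
      unfolding q_def using less i False sum_list_down
      by (simp add: nth_down down_commute[of j i])
    moreover have "down i p = up j q"
      unfolding q_def using less.prems i False by (simp add: up_down nth_down)
    moreover have "down j p = up i q"
      unfolding q_def using less.prems i False
      by (simp add: up_down nth_down down_commute[of j i])
    moreover have "w i q + w j (up i q) = w j q + w i (up j q)"
      using square less.prems i False by (simp add: q_def)
    ultimately show ?thesis using eq by simp
  qed (use eq in simp)
qed

section \<open>The counting function of a pair of good sets\<close>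

definition has :: "nat list set \<Rightarrow> nat \<Rightarrow> nat list \<Rightarrow> bool" where
  "has X i p \<longleftrightarrow> (\<exists>s\<in>X. vle p s \<and> s ! i = p ! i)"

definition inc :: "nat list set \<Rightarrow> nat list set \<Rightarrow> nat \<Rightarrow> nat list \<Rightarrow> nat" where
  "inc S E i p = of_bool (has S i p \<and> \<not> has E i p)"

lemma has_self: "p \<in> X \<Longrightarrow> has X i p"
  unfolding has_def using vle_refl by blast

lemma has_mono: "X \<subseteq> Y \<Longrightarrow> has X i p \<Longrightarrow> has Y i p"
  unfolding has_def by blast

section \<open>Consequences of (G1) and (G3) for a single good set\<close>

lemma vmeet_nth: "length a = length b \<Longrightarrow> i < length a \<Longrightarrow> vmeet a b ! i = min (a ! i) (b ! i)"
  by (simp add: vmeet_def)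

lemma length_vmeet [simp]: "length (vmeet a b) = min (length a) (length b)"
  by (simp add: vmeet_def)

lemma good_length: "good_axioms d X \<Longrightarrow> s \<in> X \<Longrightarrow> length s = d"
  unfolding good_axioms_def vecs_def by blast

lemma good_meet: "good_axioms d X \<Longrightarrow> a \<in> X \<Longrightarrow> b \<in> X \<Longrightarrow> vmeet a b \<in> X"
  unfolding good_axioms_def by blast

lemma good_exchange:
  assumes "good_axioms d X" "a \<in> X" "b \<in> X" "i < d" "a \<noteq> b" "a ! i = b ! i"
  obtains e where "e \<in> X" "a ! i < e ! i" "\<And>j. j < d \<Longrightarrow> min (a ! j) (b ! j) \<le> e ! j"
    "\<And>j. j < d \<Longrightarrow> a ! j \<noteq> b ! j \<Longrightarrow> e ! j = min (a ! j) (b ! j)"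
proof -
  have "\<exists>e\<in>X. e ! i > a ! i \<and> (\<forall>j<d. j \<noteq> i \<longrightarrow> e ! j \<ge> min (a ! j) (b ! j) \<and>
      (a ! j \<noteq> b ! j \<longrightarrow> e ! j = min (a ! j) (b ! j)))"
    using assms unfolding good_axioms_def by blast
  then obtain e where e: "e \<in> X" "e ! i > a ! i"
    and *: "\<And>j. j < d \<Longrightarrow> j \<noteq> i \<Longrightarrow> e ! j \<ge> min (a ! j) (b ! j)
      \<and> (a ! j \<noteq> b ! j \<longrightarrow> e ! j = min (a ! j) (b ! j))"
    by blast
  show thesis
  proof (rule that[OF e])
    show "min (a ! j) (b ! j) \<le> e ! j" if "j < d" for j
      using * e that by (cases "j = i") auto
    show "e ! j = min (a ! j) (b ! j)" if "j < d" "a ! j \<noteq> b ! j" for j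
      using * assms that by (cases "j = i") auto
  qed
qed

lemma good_conductor:
  assumes "good_axioms d X"
  obtains c where "c \<in> X" "length c = d" "\<And>v. vle c v \<Longrightarrow> v \<in> X"
proof -
  obtain c where "c \<in> vecs d" "\<forall>v\<in>vecs d. vle c v \<longrightarrow> v \<in> X"
    using assms unfolding good_axioms_def by blast
  then show thesis
    using that[of c] by (auto simp: vecs_def vle_def)
qed

lemma good_above:
  assumes "good_axioms d X" "length p = d" "length q = d"
  obtains s where "s \<in> X" "vle p s" "vle q s"
proof -
  obtain c where c: "length c = d" "\<And>v. vle c v \<Longrightarrow> v \<in> X"
    using good_conductor[OF assms(1)] by metis
  define s where "s = map (\<lambda>i. c ! i + p ! i + q ! i) [0..<d]"
  have "vle c s" "vle p s" "vle q s"
    using assms c by (auto simp: vle_def s_def)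
  then show thesis using that c by blast
qed

text \<open>By (G1) the meet of the witnesses for the single coordinates stays in \<open>X\<close>,
  and it agrees with \<open>p\<close> everywhere.\<close>

lemma good_has_all:
  assumes "good_axioms d X" "length p = d" "\<And>i. i < d \<Longrightarrow> has X i p"
  shows "p \<in> X"
proof -
  have "n \<le> d \<Longrightarrow> \<exists>s\<in>X. vle p s \<and> (\<forall>i<n. s ! i = p ! i)" for n
  proof (induction n)
    case 0
    then show ?case using good_above[OF assms(1,2,2)] by auto
  next
    case (Suc n)
    then obtain s t where "s \<in> X" "vle p s" "\<forall>i<n. s ! i = p ! i"
      "t \<in> X" "vle p t" "t ! n = p ! n"
      using assms(3)[of n] unfolding has_def by auto
    moreover have "length s = d" "length t = d"
      using calculation assms good_length by blast+
    moreover have "vmeet s t \<in> X" using calculation assms good_meet by blast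
    ultimately show ?case using Suc.prems assms(2)
      by (intro bexI[of _ "vmeet s t"]) (auto simp: vle_def vmeet_nth less_Suc_eq)
  qed
  then obtain s where "s \<in> X" "vle p s" "\<forall>i<d. s ! i = p ! i" by blast
  moreover from this have "s = p" using assms good_length by (metis nth_equalityI)
  ultimately show ?thesis by simp
qed

text \<open>Minimising the coordinate sum avoids an infinite meet: if the minimiser \<open>s\<close>
  were not below \<open>t\<close>, then \<open>vmeet s t\<close> would be a candidate with a smaller
  sum.\<close>

lemma good_least:
  assumes "good_axioms d X" "length p = d"
  obtains s where "s \<in> X" "vle p s" "\<And>t. t \<in> X \<Longrightarrow> vle p t \<Longrightarrow> vle s t"
proof -
  obtain s0 where "s0 \<in> X \<and> vle p s0" using good_above[OF assms assms(2)] by blast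
  then obtain s where s: "s \<in> X" "vle p s"
    and min: "\<And>t. t \<in> X \<and> vle p t \<Longrightarrow> sum_list s \<le> sum_list t"
    using ex_has_least_nat[of "\<lambda>s. s \<in> X \<and> vle p s" s0 sum_list] by blast
  have "vle s t" if t: "t \<in> X" "vle p t" for t
  proof (rule ccontr)
    assume "\<not> vle s t"
    have len: "length s = d" "length t = d" using s t assms good_length by blast+
    then obtain i where i: "i < d" "t ! i < s ! i"
      using \<open>\<not> vle s t\<close> unfolding vle_def by (metis not_le)
    have m: "vmeet s t \<in> X" "vle p (vmeet s t)"
      using s t assms len good_meet by (auto simp: vle_def vmeet_nth)
    have "vle (up i (vmeet s t)) s"
      using i len by (auto simp: vle_def nth_up vmeet_nth)
    then have "sum_list (up i (vmeet s t)) \<le> sum_list s" by (rule vle_sum_list)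
    moreover have "sum_list s \<le> sum_list (vmeet s t)" using min m by blast
    ultimately show False using sum_list_up[of i "vmeet s t"] i len by simp
  qed
  then show thesis using that s by blast
qed

section \<open>Exchange on unit squares\<close>

lemma has_up_iff:
  "i \<noteq> j \<Longrightarrow> j < length p \<Longrightarrow>
    has X i (up j p) \<longleftrightarrow> (\<exists>s\<in>X. vle p s \<and> p ! j < s ! j \<and> s ! i = p ! i)"
  by (simp add: has_def vle_up_iff nth_up conj_assoc)

lemma has_up: "i \<noteq> j \<Longrightarrow> j < length p \<Longrightarrow> has X i (up j p) \<Longrightarrow> has X i p"
  by (simp add: has_up_iff) (auto simp: has_def)

text \<open>Here (G2) makes path sums well defined. A witness \<open>s\<close> of
  \<open>has X i p\<close> has \<open>s ! j = p ! j\<close>, for otherwise it would serve at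
  \<open>up j p\<close> too. A witness \<open>t\<close> of \<open>has X j (up i p)\<close> would
  agree with \<open>s\<close> at \<open>j\<close> and differ at \<open>i\<close>, and (G2) at
  \<open>j\<close> would then give a witness of \<open>has X i (up j p)\<close>.\<close>

lemma has_exchange:
  assumes X: "good_axioms d X" and p: "length p = d" and ij: "i < d" "j < d" "i \<noteq> j"
    and has: "has X i p" "\<not> has X i (up j p)"
  shows "has X j p" "\<not> has X j (up i p)"
proof -
  obtain s where s: "s \<in> X" "vle p s" "s ! i = p ! i" using has(1) unfolding has_def by blast
  have "\<not> p ! j < s ! j" using has(2) s p ij by (subst (asm) has_up_iff) auto
  then have sj: "s ! j = p ! j" using s(2) p ij by (simp add: vle_def antisym)
  then show "has X j p" using s unfolding has_def by blast
  show "\<not> has X j (up i p)"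
  proof
    assume "has X j (up i p)"
    then obtain t where t: "t \<in> X" "vle p t" "p ! i < t ! i" "t ! j = p ! j"
      using has_up_iff[of j i p X] ij p by auto
    have "s \<noteq> t" "s ! j = t ! j" using s t sj by auto
    then obtain e where e: "e \<in> X" "s ! j < e ! j" "\<And>k. k < d \<Longrightarrow> min (s ! k) (t ! k) \<le> e ! k"
      "\<And>k. k < d \<Longrightarrow> s ! k \<noteq> t ! k \<Longrightarrow> e ! k = min (s ! k) (t ! k)"
      using good_exchange[OF X s(1) t(1) ij(2)] by blast
    have "p ! k \<le> e ! k" if "k < d" for k
      using e(3)[OF that] s(2) t(2) that p unfolding vle_def
      by (metis min.bounded_iff order_trans)
    then have "vle p e" using p good_length[OF X e(1)] by (simp add: vle_def)
    moreover have "e ! i = p ! i" using e(4)[of i] s t ij by simp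
    moreover have "p ! j < e ! j" using e(2) sj by simp
    ultimately have "has X i (up j p)"
      using has_up_iff[of i j p X] ij p e(1) by auto
    then show False using has(2) by blast
  qed
qed

text \<open>The equation compares losses: a step in direction \<open>j\<close> can only destroy
  \<open>has X i\<close>, and by \<open>has_exchange\<close> it does so exactly when a step in
  direction \<open>i\<close> destroys \<open>has X j\<close>.\<close>

lemma has_square:
  assumes "good_axioms d X" "length p = d" "i < d" "j < d" "i \<noteq> j"
  shows "of_bool (has X i p) + of_bool (has X j (up i p))
    = (of_bool (has X j p) + of_bool (has X i (up j p)) :: nat)"
proof -
  have "has X i p \<and> \<not> has X i (up j p) \<longleftrightarrow> has X j p \<and> \<not> has X j (up i p)"
    using has_exchange[OF assms] has_exchange[OF assms(1,2,4,3) assms(5)[symmetric]] by blast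
  moreover have "has X i (up j p) \<Longrightarrow> has X i p" "has X j (up i p) \<Longrightarrow> has X j p"
    using has_up assms by metis+
  ultimately show ?thesis
    by (cases "has X i p"; cases "has X j p") auto
qed

section \<open>The function \<open>g\<close> and its growth\<close>

locale good_pair =
  fixes d :: nat and S E :: "nat list set"
  assumes S: "good_axioms d S" and E: "good_axioms d E" and sub: "E \<subseteq> S"
begin

definition g :: "nat list \<Rightarrow> nat" where
  "g = pot (inc S E)"

lemma g_zero [simp]: "g (replicate d 0) = 0"
  by (simp add: g_def)

text \<open>Since \<open>E \<subseteq> S\<close>, the weight is a difference of two indicators, and
  \<open>has_square\<close> holds for each of them.\<close>

lemma inc_square:
  assumes "length q = d" "i < d" "j < d" "i \<noteq> j"
  shows "inc S E i q + inc S E j (up i q) = inc S E j q + inc S E i (up j q)"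
proof -
  have "inc S E k r + of_bool (has E k r) = of_bool (has S k r)" for k r
    using has_mono[OF sub, of k r] by (auto simp: inc_def)
  from this[of i q] this[of j "up i q"] this[of j q] this[of i "up j q"]
  show ?thesis
    using has_square[OF S assms] has_square[OF E assms] by linarith
qed

lemma g_up: "length p = d \<Longrightarrow> i < d \<Longrightarrow> g (up i p) = g p + inc S E i p"
  using pot_down[of d "inc S E" "up i p" i, OF inc_square] by (simp add: g_def nth_up)

lemma inc_le: "inc S E i p \<le> 1"
  by (simp add: inc_def)

lemma g_mono:
  assumes "vle p q" "length p = d"
  shows "g p \<le> g q"
  using assms(1)
proof (induction rule: climb)
  case (step r)
  then obtain i where "i < length r" "r ! i < q ! i" using vle_obtain_less by metis
  with step assms(2) show ?case
    by (intro exI[of _ i]) (auto simp: g_up vle_def)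
qed simp

text \<open>\<open>a\<close> itself witnesses \<open>has S i a\<close> in all directions, while
  \<open>good_has_all\<close> would put \<open>a\<close> in \<open>E\<close> if
  \<open>has E i a\<close> never failed. So a counted step leaves every point of
  \<open>S - E\<close>.\<close>

lemma inc_one:
  assumes "a \<in> S - E"
  obtains i where "i < d" "\<not> has E i a" "inc S E i a = 1"
proof -
  have "length a = d" using assms S good_length by blast
  then obtain i where "i < d" "\<not> has E i a" using good_has_all[OF E] assms by blast
  then show thesis using that assms has_self[of a S i] by (simp add: inc_def)
qed

lemma g_less:
  assumes "a \<in> S - E" "vle a b" "\<And>i. i < d \<Longrightarrow> \<not> has E i a \<Longrightarrow> a ! i < b ! i"
  shows "g a < g b"
proof -
  have len: "length a = d" using assms S good_length by blast
  obtain i where i: "i < d" "\<not> has E i a" "inc S E i a = 1" using inc_one assms by blast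
  then have "vle (up i a) b" using assms len by (simp add: vle_up_iff)
  then have "g (up i a) \<le> g b" using len g_mono by simp
  then show ?thesis using i len by (simp add: g_up)
qed

lemma g_less_vll: "a \<in> S - E \<Longrightarrow> vll a b \<Longrightarrow> g a < g b"
  using S good_length by (intro g_less) (auto simp: vll_def vle_def less_imp_le)

lemma g_less_ideal:
  assumes "a \<in> S - E" "vle a b" "b \<in> E"
  shows "g a < g b"
proof (rule g_less[OF assms(1,2)])
  fix i assume i: "i < d" "\<not> has E i a"
  moreover have "length a = d" using assms S good_length by blast
  \<comment> \<open>If \<open>b ! i = a ! i\<close>, then \<open>b\<close> would witness
    \<open>has E i a\<close>.\<close>
  ultimately show "a ! i < b ! i"
    using assms unfolding has_def vle_def by (metis le_neq_implies_less)
qed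

text \<open>A discrete intermediate value property. Climb towards \<open>c\<close> while
  \<open>g\<close> stays at most \<open>m\<close>; where this stops, every step towards
  \<open>c\<close> is counted, which forces the current point into \<open>S - E\<close>.\<close>

lemma exists_between:
  assumes "c \<in> E" "vle p c" "g p \<le> m" "m < g c"
  obtains q where "q \<in> S - E" "vle p q" "vle q c" "g q = m"
proof -
  have lc: "length c = d" using assms E good_length by blast
  have "vle p c \<Longrightarrow> g p \<le> m \<Longrightarrow> \<exists>q\<in>S - E. vle p q \<and> vle q c \<and> g q = m"
  proof (induction "sum_list c - sum_list p" arbitrary: p rule: less_induct)
    case less
    have lp: "length p = d" using less.prems lc by (simp add: vle_def)
    show ?case
    proof (cases "\<exists>i<d. p ! i < c ! i \<and> g (up i p) \<le> m")
      case True
      then obtain i where i: "i < d" "p ! i < c ! i" "g (up i p) \<le> m" by blast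
      then have v: "vle (up i p) c" using less.prems lp by (simp add: vle_up_iff)
      moreover have "sum_list c - sum_list (up i p) < sum_list c - sum_list p"
        using vle_sum_list[OF v] i lp by (simp add: sum_list_up)
      ultimately obtain q where "q \<in> S - E" "vle (up i p) q" "vle q c" "g q = m"
        using less.hyps i by blast
      then show ?thesis using vle_up vle_trans by blast
    next
      case False
      \<comment> \<open>Steps raise \<open>g\<close> by at most one, so a step that would exceed
        \<open>m\<close> is counted and starts at the value \<open>m\<close> exactly.\<close>
      have up: "inc S E i p = 1 \<and> g p = m" if "i < d" "p ! i < c ! i" for i
        using False that less.prems g_up[OF lp, of i] inc_le[of i p] by force
      obtain i where i: "i < d" "p ! i < c ! i"
        using vle_obtain_less[OF less.prems(1)] lp assms(4) less.prems(2) by (metis not_le)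
      have "has S j p" if j: "j < d" for j
      proof (cases "p ! j < c ! j")
        case True
        then show ?thesis using up[OF j] by (cases "has S j p") (simp_all add: inc_def)
      next
        case False
        \<comment> \<open>In a direction that is already completed, \<open>c\<close> itself
          witnesses \<open>has S j p\<close>.\<close>
        then have "c ! j = p ! j" using less.prems j lp by (simp add: vle_def le_antisym)
        then show ?thesis using assms(1) sub less.prems unfolding has_def by blast
      qed
      then have "p \<in> S" using good_has_all[OF S lp] by blast
      moreover have "p \<notin> E" using up[OF i] has_self[of p E i] by (auto simp: inc_def)
      ultimately show ?thesis using up[OF i] less.prems by (intro bexI[of _ p]) auto
    qed
  qed
  then show thesis using that assms by blast
qed

text \<open>No step towards \<open>s\<close> is counted: a witness of \<open>has S i q\<close> would
  lie in \<open>S\<close> above \<open>p\<close>, hence above \<open>s\<close>, although its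
  coordinate \<open>q ! i\<close> is less than \<open>s ! i\<close>.\<close>

lemma g_least:
  assumes "length p = d" "vle p s" "\<And>t. t \<in> S \<Longrightarrow> vle p t \<Longrightarrow> vle s t"
  shows "g s = g p"
  using assms(2)
proof (induction rule: climb)
  case (step q)
  then obtain i where i: "i < length q" "q ! i < s ! i" using vle_obtain_less by metis
  have lq: "length q = d" using step assms by (simp add: vle_def)
  have "\<not> has S i q"
  proof
    assume "has S i q"
    then obtain t where "t \<in> S" "vle q t" "t ! i = q ! i" unfolding has_def by blast
    moreover from this have "vle s t" using assms step vle_trans by blast
    ultimately show False using i step.hyps lq by (auto simp: vle_def)
  qed
  then show ?case using i step lq by (intro exI[of _ i]) (simp add: g_up inc_def)
qed simp

section \<open>Peeling off the levels\<close>

text \<open>In a counted direction \<open>i\<close> some member of the family must exceed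
  \<open>a\<close>, since not all of them agree with \<open>a\<close> there. It lies above
  \<open>up i a\<close>, so its value of \<open>g\<close> is too large.\<close>

lemma not_complete_inf:
  assumes "a \<in> S - E" "B \<subseteq> {b \<in> S - E. g b \<le> g a}"
  shows "\<not> complete_inf d B a"
proof
  assume "complete_inf d B a"
  then have "\<exists>Bs\<subseteq>B. (\<forall>b\<in>Bs. \<forall>j<d. b ! j \<noteq> a ! j \<longrightarrow> b ! j > a ! j) \<and>
      (\<forall>i<d. \<exists>b\<in>Bs. b ! i \<noteq> a ! i)"
    unfolding complete_inf_def by (elim conjE exE) (intro exI conjI; simp)
  then obtain Bs where Bs: "Bs \<subseteq> B" "\<forall>b\<in>Bs. \<forall>j<d. b ! j \<noteq> a ! j \<longrightarrow> b ! j > a ! j"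
    "\<forall>i<d. \<exists>b\<in>Bs. b ! i \<noteq> a ! i"
    by blast
  obtain i where i: "i < d" "inc S E i a = 1" using inc_one assms(1) by blast
  obtain b where b: "b \<in> Bs" "b ! i \<noteq> a ! i" using Bs(3) i(1) by blast
  then have bB: "b \<in> S" "g b \<le> g a" using Bs(1) assms(2) by auto
  have len: "length a = d" "length b = d" using bB assms(1) good_length[OF S] by simp_all
  have "a ! j \<le> b ! j" if "j < d" for j
    using bspec[OF Bs(2) b(1)] that by (cases "b ! j = a ! j") (auto intro: less_imp_le)
  then have "vle a b" using len by (simp add: vle_def)
  moreover have "a ! i < b ! i" using bspec[OF Bs(2) b(1)] i(1) b(2) by simp
  ultimately have "vle (up i a) b" using i len by (simp add: vle_up_iff)
  then have "g (up i a) \<le> g b" using g_mono len by simp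
  then show False using bB i len by (simp add: g_up)
qed

text \<open>The assumption on \<open>B\<close> anticipates the maximal elements of a remaining set.
  The direction \<open>i\<close> serves twice: it keeps the \<open>f k\<close> with
  \<open>k \<in> K\<close> outside \<open>E\<close>, and it bounds the size of the family by
  \<open>d\<close>.\<close>

lemma complete_infI:
  assumes a: "a \<in> S - E" and c: "c \<in> S - E" "vle a c" "g c = Suc (g a)"
    and i: "i < d" "\<not> has E i a" "a ! i < c ! i" and "\<not> vll a c"
    and B: "\<And>b. b \<in> S - E \<Longrightarrow> vle a b \<Longrightarrow> g b \<le> Suc (g a) \<Longrightarrow> b \<in> B"
  shows "complete_inf d B a"
proof -
  have len: "length a = d" "length c = d" using a c S good_length by blast+
  have "\<exists>s\<in>S. vle (up k a) s \<and> (\<forall>t\<in>S. vle (up k a) t \<longrightarrow> vle s t)" for k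
    by (rule good_least[OF S, of "up k a"]) (use len in auto)
  then obtain f where f: "\<forall>k. f k \<in> S \<and> vle (up k a) (f k) \<and>
      (\<forall>t\<in>S. vle (up k a) t \<longrightarrow> vle (f k) t)"
    using bchoice[of UNIV] by (metis (no_types, lifting))
  have fS: "f k \<in> S" and fup: "vle (up k a) (f k)" for k
    using f by simp_all
  have least: "vle (f k) t" if "t \<in> S" "vle (up k a) t" for k t
    using f that by simp
  have lf: "length (f k) = d" for k using good_length[OF S fS] .
  have fa: "vle a (f k)" for k using vle_trans[OF vle_up fup] .
  have fk: "a ! k < f k ! k" if "k < d" for k using fup[of k] that len by (simp add: vle_up_iff)
  have gf: "g (f k) \<le> Suc (g a)" if "k < d" for k
    using g_least[OF _ fup least, of k] len g_up[of a k] inc_le[of k a] that by simp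
  \<comment> \<open>(G2) at \<open>k\<close> raises \<open>a\<close> there without raising it where
    \<open>t\<close> exceeds \<open>a\<close>. The resulting \<open>e\<close> lies above
    \<open>f k\<close>, so \<open>f k\<close> does not exceed \<open>a\<close> at those coordinates
    either.\<close>
  have disj: "t ! j = a ! j \<or> f k ! j = a ! j"
    if t: "t \<in> S" "vle a t" "t ! k = a ! k" and k: "k < d" "j < d" for t k j
  proof (cases "t = a")
    case False
    have "length t = d" using good_length[OF S t(1)] .
    then have at: "min (a ! j) (t ! j) = a ! j" if "j < d" for j
      using t that len by (simp add: vle_def)
    obtain e where e: "e \<in> S" "a ! k < e ! k" "\<And>j. j < d \<Longrightarrow> min (a ! j) (t ! j) \<le> e ! j"
      "\<And>j. j < d \<Longrightarrow> a ! j \<noteq> t ! j \<Longrightarrow> e ! j = min (a ! j) (t ! j)"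
      using good_exchange[OF S _ t(1) k(1) False[symmetric] t(3)[symmetric]] a by blast
    have "length e = d" using good_length[OF S e(1)] .
    moreover have "vle a e" using e(3) at len calculation by (simp add: vle_def)
    ultimately have "vle (up k a) e" using e(2) k len by (simp add: vle_up_iff)
    then have "vle (f k) e" using least e(1) by blast
    then have "f k ! j \<le> e ! j" "a ! j \<le> f k ! j"
      using fa[of k] k lf len by (simp_all add: vle_def)
    then show ?thesis using e(4)[OF k(2)] at[OF k(2)] by (cases "a ! j = t ! j") auto
  qed simp
  \<comment> \<open>If both exceed \<open>a\<close> at \<open>j\<close>, then by \<open>disj\<close>
    each exceeds \<open>a\<close> at the index of the other. So \<open>f k\<close> lies above
    \<open>up l a\<close> and \<open>f l\<close> above \<open>up k a\<close>, and leastness compares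
    them both ways.\<close>
  have ff: "f k = f l" if "k < d" "l < d" "j < d" "f k ! j \<noteq> a ! j" "f l ! j \<noteq> a ! j" for k l j
  proof (rule vle_antisym)
    have "f x ! y \<noteq> a ! y" if "x < d" "y < d" "f x ! j \<noteq> a ! j" "f y ! j \<noteq> a ! j" for x y
      using disj[OF fS fa, of x y j] that \<open>j < d\<close> by blast
    then have "f k ! l \<noteq> a ! l" "f l ! k \<noteq> a ! k" using that by blast+
    then have "a ! l < f k ! l" "a ! k < f l ! k"
      using that fa[of k] fa[of l] len by (simp_all add: vle_def le_neq_implies_less)
    then show "vle (f k) (f l)" "vle (f l) (f k)"
      using that fa fS len least by (simp_all add: vle_up_iff)
  qed
  define K where "K = {k. k < d \<and> c ! k = a ! k}"
  have cf: "c ! j = a ! j \<or> f k ! j = a ! j" if "k \<in> K" "j < d" for k j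
    using disj[of c k j] c that by (simp add: K_def)
  define Bs where "Bs = insert c (f ` K)"
  obtain k where k: "k \<in> K"
    using \<open>\<not> vll a c\<close> c(2) len unfolding K_def vll_def vle_def by (auto simp: not_less antisym)
  have Kd: "x < d" if "x \<in> K" for x using that by (simp add: K_def)
  have "finite K" by (simp add: K_def)
  \<comment> \<open>\<open>c\<close> exceeds \<open>a\<close> at \<open>i\<close>, so
    \<open>f x\<close> agrees with \<open>a\<close> there; were it in \<open>E\<close>, it would
    witness \<open>has E i a\<close>.\<close>
  have fi: "f x ! i = a ! i" if "x \<in> K" for x using cf[of x i] that i by auto
  have fE: "f x \<notin> E" if "x \<in> K" for x
    using fi[OF that] fa[of x] i(2) unfolding has_def by metis
  have "c \<in> B" using B[OF c(1,2)] c(3) by simp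
  moreover have "f x \<in> B" if "x \<in> K" for x
    using B[OF _ fa gf[OF Kd[OF that]]] fS fE[OF that] by simp
  ultimately have sub: "Bs \<subseteq> B" unfolding Bs_def by blast
  have fin: "finite Bs" using \<open>finite K\<close> by (simp add: Bs_def)
  \<comment> \<open>\<open>i\<close> is not in \<open>K\<close>, so there are at most
    \<open>d - 1\<close> elements \<open>f k\<close>, which leaves room for
    \<open>c\<close>.\<close>
  have le: "card Bs \<le> d"
  proof -
    have "K \<subseteq> {..<d} - {i}" using i(3) unfolding K_def by auto
    then have "card K \<le> card ({..<d} - {i})" by (intro card_mono) simp_all
    then have "card K < d" using i(1) by simp
    moreover have "card (f ` K) \<le> card K" using \<open>finite K\<close> by (rule card_image_le)
    ultimately show ?thesis using \<open>finite K\<close> by (simp add: Bs_def card_insert_if)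
  qed
  have ge: "2 \<le> card Bs"
  proof -
    have "{c, f k} \<subseteq> Bs" using k by (simp add: Bs_def)
    moreover have "c \<noteq> f k" using fk[OF Kd[OF k]] k by (auto simp: K_def)
    ultimately show ?thesis using card_mono[OF fin, of "{c, f k}"] by simp
  qed
  have nonempty: "\<exists>j<d. b ! j = a ! j" and proper: "\<exists>j<d. b ! j \<noteq> a ! j" if b: "b \<in> Bs" for b
  proof -
    have "(\<exists>j<d. b ! j = a ! j) \<and> (\<exists>j<d. b ! j \<noteq> a ! j)"
    proof (cases "b = c")
      case True
      have "c ! k = a ! k" "k < d" using k by (simp_all add: K_def)
      then show ?thesis using True i by (metis less_irrefl)
    next
      case False
      then obtain x where x: "x \<in> K" "b = f x" using b unfolding Bs_def by blast
      then show ?thesis using fi[OF x(1)] fk[OF Kd[OF x(1)]] Kd[OF x(1)] i(1)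
        by (metis less_irrefl)
    qed
    then show "\<exists>j<d. b ! j = a ! j" "\<exists>j<d. b ! j \<noteq> a ! j" by simp_all
  qed
  have above: "length b = d" "vle a b" if "b \<in> Bs" for b
    using that c(2) fa lf len unfolding Bs_def by auto
  have greater: "b ! j > a ! j" if "b \<in> Bs" "j < d" "b ! j \<noteq> a ! j" for b j
    using above[OF that(1)] that len by (simp add: vle_def le_neq_implies_less)
  have meet: "vmeet b b' = a" if b: "b \<in> Bs" "b' \<in> Bs" "b \<noteq> b'" for b b'
  proof (rule nth_equalityI)
    show "length (vmeet b b') = length a" using above[OF b(1)] above[OF b(2)] len by simp
    fix j assume "j < length (vmeet b b')"
    then have j: "j < d" using above[OF b(1)] above[OF b(2)] by simp
    consider "b = c" "b' \<in> f ` K" | "b' = c" "b \<in> f ` K" | "b \<in> f ` K" "b' \<in> f ` K"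
      using b unfolding Bs_def by blast
    then have "b ! j = a ! j \<or> b' ! j = a ! j"
    proof cases
      case 3
      then obtain x y where xy: "x \<in> K" "b = f x" "y \<in> K" "b' = f y" by blast
      then show ?thesis using ff[OF Kd[OF xy(1)] Kd[OF xy(3)] j] b(3) by blast
    qed (use cf j in blast)+
    moreover have "a ! j \<le> b ! j" "a ! j \<le> b' ! j"
      using above[OF b(1)] above[OF b(2)] j len by (simp_all add: vle_def)
    ultimately show "vmeet b b' ! j = a ! j"
      using above[OF b(1)] above[OF b(2)] j by (auto simp: vmeet_nth min_def)
  qed
  \<comment> \<open>Outside \<open>K\<close> this is \<open>c\<close>, and for \<open>j\<close> in
    \<open>K\<close> it is \<open>f j\<close>.\<close>
  have cover: "\<exists>b\<in>Bs. b ! j \<noteq> a ! j" if "j < d" for j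
    using that fk[of j] unfolding Bs_def K_def by (cases "c ! j = a ! j") auto
  have "a \<in> B" using B a by simp
  then show ?thesis
    unfolding complete_inf_def
    by (intro conjI exI[of _ Bs] ballI allI impI)
      (rule sub fin ge le nonempty proper greater meet cover; assumption | assumption)+
qed

text \<open>For \<open>d = 0\<close> the relation \<open>vll\<close> holds vacuously between
  \<open>[]\<close> and itself, so irreflexivity on \<open>R\<close> is drawn from the strict growth
  of \<open>g\<close>.\<close>

lemma mem_maxl_iff:
  assumes "R \<subseteq> S - E"
  shows "a \<in> maxl R \<longleftrightarrow> a \<in> R \<and> (\<forall>b\<in>R. \<not> vll a b)"
proof -
  have "\<not> vll a a" if "a \<in> R"
    using g_less_vll[of a a] assms that by blast
  then show ?thesis unfolding maxl_def vlele_def by blast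
qed

text \<open>The element \<open>e\<close> provides points of \<open>E\<close> with value above
  \<open>m\<close>, the upper end from which \<open>exists_between\<close> finds an element of
  \<open>S - E\<close> one value above a given \<open>a\<close>.\<close>

lemma Dstep_eq:
  assumes "e \<in> E" "m < g e"
  shows "Dstep d {a \<in> S - E. g a \<le> m} = {a \<in> S - E. g a = m}" (is "Dstep d ?R = ?D")
proof
  have maxl: "b \<in> maxl ?R \<longleftrightarrow> b \<in> ?R \<and> (\<forall>x\<in>?R. \<not> vll b x)" for b
    by (rule mem_maxl_iff) blast
  show "?D \<subseteq> Dstep d ?R"
  proof
    fix a assume a: "a \<in> ?D"
    then have "a \<in> maxl ?R"
      using g_less_vll[of a] unfolding maxl by (auto dest: leD)
    moreover have "\<not> complete_inf d (maxl ?R) a"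
      using a by (intro not_complete_inf) (auto simp: maxl_def)
    ultimately show "a \<in> Dstep d ?R" by (simp add: Dstep_def)
  qed
  show "Dstep d ?R \<subseteq> ?D"
  proof
    fix a
    assume "a \<in> Dstep d ?R"
    then have "a \<in> maxl ?R" and nc: "\<not> complete_inf d (maxl ?R) a"
      unfolding Dstep_def by blast+
    then have a: "a \<in> S - E" "g a \<le> m" and max: "\<And>b. b \<in> ?R \<Longrightarrow> \<not> vll a b"
      unfolding maxl by blast+
    have la: "length a = d" using a(1) good_length[OF S] by blast
    have "\<not> g a < m"
    proof
      assume less: "g a < m"
      obtain i where i: "i < d" "\<not> has E i a" "inc S E i a = 1" using inc_one a by blast
      obtain u where u: "u \<in> E" "vle (up i a) u" "vle e u"
        using good_above[OF E, of "up i a" e] la assms E good_length by (metis length_up)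
      have "m < g u" using assms u g_mono[OF u(3)] good_length[OF E] by force
      \<comment> \<open>Searching above \<open>up i a\<close> rather than \<open>a\<close> ensures
        \<open>a ! i < c ! i\<close>, and \<open>up i a\<close> already has the value
        \<open>Suc (g a)\<close>.\<close>
      then obtain c where c: "c \<in> S - E" "vle (up i a) c" "g c = Suc (g a)"
        using exists_between[OF u(1,2), of "Suc (g a)"] la i less by (auto simp: g_up)
      have ac: "vle a c" "a ! i < c ! i" using c i la by (simp_all add: vle_up_iff)
      have "complete_inf d (maxl ?R) a"
      proof (rule complete_infI[OF a(1) c(1) ac(1) c(3) i(1,2) ac(2)])
        show "\<not> vll a c" using max c less by simp
        fix b assume b: "b \<in> S - E" "vle a b" "g b \<le> Suc (g a)"
        \<comment> \<open>Whatever exceeds \<open>b\<close> in all coordinates also exceeds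
          \<open>a\<close> in all of them, so elements of \<open>?R\<close> above the maximal
          \<open>a\<close> are maximal too.\<close>
        have "\<not> vll b x" if "x \<in> ?R" for x
          using max[OF that] b(2) unfolding vll_def vle_def by (metis le_less_trans)
        then show "b \<in> maxl ?R" unfolding maxl using b less by auto
      qed
      then show False using nc by blast
    qed
    then show "a \<in> ?D" using a by simp
  qed
qed

section \<open>The number of levels and the level function\<close>

text \<open>Above a conductor \<open>e\<close> of \<open>E\<close> all points lie in
  \<open>E\<close>, so no step is counted and \<open>g\<close> is constant there; and every
  \<open>p\<close> lies below such a point.\<close>

lemma g_top:
  obtains e where "e \<in> E" "\<And>p. length p = d \<Longrightarrow> g p \<le> g e"
proof -
  obtain e where e: "e \<in> E" "length e = d" "\<And>v. vle e v \<Longrightarrow> v \<in> E"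
    using good_conductor[OF E] by metis
  have "g p \<le> g e" if p: "length p = d" for p
  proof -
    obtain u where u: "vle p u" "vle e u" using good_above[OF E p e(2)] by blast
    have "g u = g e" using u(2)
    proof (induction rule: climb)
      case (step q)
      then obtain i where i: "i < length q" "q ! i < u ! i" using vle_obtain_less by metis
      have "has E i q" using e(3)[OF step.hyps(1)] by (rule has_self)
      then show ?case using i step e(2)
        by (intro exI[of _ i]) (simp add: g_up inc_def vle_def)
    qed simp
    then show ?thesis using g_mono[OF u(1) p] by simp
  qed
  then show thesis using that e by blast
qed

text \<open>Each round of peeling removes the largest remaining value of \<open>g\<close>. With
  \<open>G\<close> the maximum of \<open>g\<close>, the set left after \<open>G - k\<close> rounds
  consists of the points with \<open>g a < k\<close>, so the next round removes the value
  \<open>k - 1\<close>.\<close>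

lemma levels:
  shows less_nlevels: "a \<in> S - E \<Longrightarrow> g a < nlevels d (S - E)"
    and levelset_eq: "1 \<le> k \<Longrightarrow> k \<le> nlevels d (S - E) \<Longrightarrow>
      levelset d (S - E) k = {a \<in> S - E. Suc (g a) = k}"
proof -
  obtain e where e: "e \<in> E" "\<And>p. length p = d \<Longrightarrow> g p \<le> g e" using g_top by blast
  define G where "G = g e"
  have less: "g a < G" if "a \<in> S - E" for a
  proof -
    have "length a = d" using that S good_length by blast
    then obtain u where "u \<in> E" "vle a u" using good_above[OF E] by metis
    then show ?thesis using g_less_ideal[OF that] e(2)[of u] good_length[OF E] unfolding G_def
      by (meson less_le_trans)
  qed
  have Dstep: "Dstep d {a \<in> S - E. g a < Suc m} = {a \<in> S - E. g a = m}" if "m < G" for m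
    using Dstep_eq[OF e(1), of m] that by (simp add: G_def less_Suc_eq_le)
  have rem: "n \<le> G \<Longrightarrow> remaining d (S - E) n = {a \<in> S - E. g a < G - n}" for n
  proof (induction n)
    case 0
    then show ?case using less by auto
  next
    case (Suc n)
    then have "G - n = Suc (G - Suc n)" "G - Suc n < G" by auto
    then show ?case using Suc Dstep[of "G - Suc n"] by auto
  qed
  have nlevels: "nlevels d (S - E) = G"
    unfolding nlevels_def
  proof (rule Least_equality)
    show "remaining d (S - E) G = {}" using rem by simp
    fix n assume n: "remaining d (S - E) n = {}"
    show "G \<le> n"
    proof (rule ccontr)
      assume "\<not> G \<le> n"
      \<comment> \<open>The value 0 is attained on \<open>S - E\<close>, so the process cannot end
        before round \<open>G\<close>.\<close>
      moreover from this obtain q where "q \<in> S - E" "g q = 0"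
        using exists_between[OF e(1), of "replicate d 0" 0] vle_replicate_0[of e d]
          good_length[OF E e(1)] by (auto simp: G_def)
      ultimately have "q \<in> remaining d (S - E) n" using rem[of n] by simp
      then show False using n by simp
    qed
  qed
  show "g a < nlevels d (S - E)" if "a \<in> S - E"
    using less that nlevels by simp
  assume "1 \<le> k" "k \<le> nlevels d (S - E)"
  then obtain m where "k = Suc m" "m < G" using nlevels by (cases k) auto
  then show "levelset d (S - E) k = {a \<in> S - E. Suc (g a) = k}"
    using nlevels rem[of "G - k"] Dstep[of m] by (simp add: levelset_def)
qed

lemma level_of_eq:
  assumes "a \<in> S - E"
  shows "level_of d (S - E) a = Suc (g a)"
  unfolding level_of_def
proof (rule the_equality)
  have "Suc (g a) \<le> nlevels d (S - E)" using less_nlevels[OF assms] by simp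
  then show "1 \<le> Suc (g a) \<and> Suc (g a) \<le> nlevels d (S - E) \<and> a \<in> levelset d (S - E) (Suc (g a))"
    using assms levelset_eq[of "Suc (g a)"] by simp
  show "k = Suc (g a)" if "1 \<le> k \<and> k \<le> nlevels d (S - E) \<and> a \<in> levelset d (S - E) k" for k
    using that levelset_eq[of k] by simp
qed

text \<open>For \<open>a\<close> in \<open>E\<close>, every smaller \<open>t\<close> in
  \<open>S - E\<close> has \<open>Suc (g t) \<le> g a\<close> by \<open>g_less_ideal\<close>, and
  \<open>exists_between\<close>, started at the origin, attains equality if
  \<open>g a > 0\<close>.\<close>

lemma level_fun_eq:
  assumes "a \<in> S"
  shows "level_fun d (S - E) a = Suc (g a)"
proof (cases "a \<in> E")
  case True
  let ?M = "{i. 1 \<le> i \<and> i \<le> nlevels d (S - E) \<and> (\<exists>t\<in>levelset d (S - E) i. vlt t a)}"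
  have M: "?M = {Suc (g t) | t. t \<in> S - E \<and> vlt t a}"
    using less_nlevels levelset_eq by (auto simp: Suc_le_eq)
  have "Max ({0} \<union> ?M) = g a"
  proof (rule Max_eqI)
    show "finite ({0} \<union> ?M)" by simp
    show "y \<le> g a" if "y \<in> {0} \<union> ?M" for y
      using that g_less_ideal[OF _ _ True] unfolding M by (auto simp: Suc_le_eq vlt_def)
    show "g a \<in> {0} \<union> ?M"
    \<comment> \<open>For \<open>g a = 0\<close> the maximum is the adjoined default 0.\<close>
    proof (cases "g a")
      case (Suc m)
      then obtain q where "q \<in> S - E" "vle q a" "g q = m"
        using exists_between[OF True, of "replicate d 0" m] vle_replicate_0[of a d]
          good_length[OF E True] by auto
      moreover from this have "vlt q a" using True by (auto simp: vlt_def)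
      ultimately show ?thesis using Suc unfolding M by auto
    qed simp
  qed
  then show ?thesis using True by (simp add: level_fun_def)
qed (use assms level_of_eq in \<open>simp add: level_fun_def\<close>)

end

section \<open>Products\<close>

lemma vle_append:
  assumes "length a = length c"
  shows "vle (a @ b) (c @ e) \<longleftrightarrow> vle a c \<and> vle b e"
proof -
  have *: "vle p q \<longleftrightarrow> list_all2 (\<le>) p q" for p q :: "nat list"
    by (auto simp: vle_def list_all2_conv_all_nth)
  show ?thesis using assms by (simp add: * list_all2_append)
qed

lemma vmeet_append:
  "length a = length c \<Longrightarrow> vmeet (a @ b) (c @ e) = vmeet a c @ vmeet b e"
  by (simp add: vmeet_def)

text \<open>The case \<open>a = b\<close> is needed for points of a product that differ in one factor only.\<close>

lemma good_exchange_weak: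
  assumes X: "good_axioms d X" and ab: "a \<in> X" "b \<in> X" and i: "i < d" "a ! i = b ! i"
  obtains e where "e \<in> X" "a ! i < e ! i" "\<And>j. j < d \<Longrightarrow> min (a ! j) (b ! j) \<le> e ! j"
    "\<And>j. j < d \<Longrightarrow> a ! j \<noteq> b ! j \<Longrightarrow> e ! j = min (a ! j) (b ! j)"
proof (cases "a = b")
  case True
  have la: "length a = d" using ab X good_length by blast
  obtain e where e: "e \<in> X" "vle (up i a) e"
    using good_above[OF X, of "up i a" a] la by auto
  then have "vle a e" "a ! i < e ! i" using i la by (simp_all add: vle_up_iff)
  then show thesis using e that[of e] True la by (auto simp: vle_def)
qed (use good_exchange[OF X ab(1,2) i(1) _ i(2)] that in blast)

text \<open>For (G2), exchange in the factor that contains the coordinate \<open>i\<close> and take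
  the meet in the other. The two points may coincide in the factor of \<open>i\<close>, whence
  \<open>good_exchange_weak\<close>.\<close>

lemma good_axioms_prodset:
  assumes X: "good_axioms d X" and Y: "good_axioms d' Y"
  shows "good_axioms (d + d') (prodset X Y)"
proof -
  have lX: "length a = d" if "a \<in> X" for a using that X good_length by blast
  have lY: "length a = d'" if "a \<in> Y" for a using that Y good_length by blast
  have mem: "a @ b \<in> prodset X Y" if "a \<in> X" "b \<in> Y" for a b
    using that unfolding prodset_def by blast
  show ?thesis
    unfolding good_axioms_def
  proof (intro conjI ballI allI impI)
    show "prodset X Y \<subseteq> vecs (d + d')"
      using lX lY by (auto simp: prodset_def vecs_def)
    show "vmeet p q \<in> prodset X Y" if pq: "p \<in> prodset X Y" "q \<in> prodset X Y" for p q
    proof -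
      obtain a b a' b' where "p = a @ a'" "q = b @ b'" "a \<in> X" "b \<in> X" "a' \<in> Y" "b' \<in> Y"
        using pq unfolding prodset_def by blast
      then show ?thesis
        using good_meet X Y mem lX by (simp add: vmeet_append)
    qed
  next
    fix p q i
    assume pq: "p \<in> prodset X Y" "q \<in> prodset X Y" and i: "i < d + d'" "p \<noteq> q \<and> p ! i = q ! i"
    then obtain a b a' b' where
      eq: "p = a @ a'" "q = b @ b'" and mems: "a \<in> X" "b \<in> X" "a' \<in> Y" "b' \<in> Y"
      unfolding prodset_def by blast
    have len: "length a = d" "length b = d" "length a' = d'" "length b' = d'"
      using mems lX lY by auto
    have "\<exists>e\<in>prodset X Y. p ! i < e ! i \<and> (\<forall>j<d + d'. min (p ! j) (q ! j) \<le> e ! j \<and>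
        (j \<noteq> i \<longrightarrow> p ! j \<noteq> q ! j \<longrightarrow> e ! j = min (p ! j) (q ! j)))"
    proof (cases "i < d")
      case True
      then have "a ! i = b ! i" using i(2) eq len by (simp add: nth_append)
      then obtain e where e: "e \<in> X" "a ! i < e ! i"
        "\<And>j. j < d \<Longrightarrow> min (a ! j) (b ! j) \<le> e ! j"
        "\<And>j. j < d \<Longrightarrow> a ! j \<noteq> b ! j \<Longrightarrow> e ! j = min (a ! j) (b ! j)"
        using good_exchange_weak[OF X mems(1,2) True] by blast
      show ?thesis
        using e True len lX[OF e(1)] mems good_meet[OF Y]
        by (intro bexI[of _ "e @ vmeet a' b'"])
          (auto simp: eq nth_append vmeet_nth intro: mem)
    next
      case False
      then have "i - d < d'" "a' ! (i - d) = b' ! (i - d)"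
        using i eq len by (auto simp: nth_append)
      then obtain e where e: "e \<in> Y" "a' ! (i - d) < e ! (i - d)"
        "\<And>j. j < d' \<Longrightarrow> min (a' ! j) (b' ! j) \<le> e ! j"
        "\<And>j. j < d' \<Longrightarrow> a' ! j \<noteq> b' ! j \<Longrightarrow> e ! j = min (a' ! j) (b' ! j)"
        using good_exchange_weak[OF Y mems(3,4)] by blast
      show ?thesis
        using e False len mems good_meet[OF X]
        by (intro bexI[of _ "vmeet a b @ e"])
          (auto simp: eq nth_append vmeet_nth intro: mem)
    qed
    then show "\<exists>e\<in>prodset X Y. p ! i < e ! i \<and> (\<forall>j<d + d'. j \<noteq> i \<longrightarrow>
        min (p ! j) (q ! j) \<le> e ! j \<and> (p ! j \<noteq> q ! j \<longrightarrow> e ! j = min (p ! j) (q ! j)))"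
      by blast
  next
    obtain c c' where c: "length c = d" "\<And>v. vle c v \<Longrightarrow> v \<in> X"
      "length c' = d'" "\<And>v. vle c' v \<Longrightarrow> v \<in> Y"
      using good_conductor[OF X] good_conductor[OF Y] by metis
    have "v \<in> prodset X Y" if v: "length v = d + d'" "vle (c @ c') v" for v
    proof -
      have "vle c (take d v)" "vle c' (drop d v)"
        using v c vle_append[of c "take d v" c' "drop d v"] by simp_all
      then show ?thesis using c mem[of "take d v" "drop d v"] by simp
    qed
    then show "\<exists>c\<in>vecs (d + d'). \<forall>v\<in>vecs (d + d'). vle c v \<longrightarrow> v \<in> prodset X Y"
      using c by (intro bexI[of _ "c @ c'"]) (auto simp: vecs_def)
  qed
qed

text \<open>The second factor imposes no condition: \<open>good_above\<close> completes any witness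
  from \<open>X\<close> by an element of \<open>Y\<close> above \<open>q\<close>.\<close>

lemma has_append_left:
  assumes "good_axioms d X" "good_axioms d' Y" "length p = d" "length q = d'" "i < d"
  shows "has (prodset X Y) i (p @ q) \<longleftrightarrow> has X i p"
proof
  assume "has (prodset X Y) i (p @ q)"
  then obtain a b where "a \<in> X" "b \<in> Y" "vle (p @ q) (a @ b)" "(a @ b) ! i = (p @ q) ! i"
    unfolding has_def prodset_def by blast
  moreover from this have "length a = d" using assms good_length by blast
  ultimately show "has X i p" using assms by (auto simp: has_def vle_append nth_append)
next
  assume "has X i p"
  then obtain a where a: "a \<in> X" "vle p a" "a ! i = p ! i" unfolding has_def by blast
  obtain b where "b \<in> Y" "vle q b" using good_above[OF assms(2,4,4)] by blast
  moreover have "length a = d" using a assms good_length by blast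
  ultimately show "has (prodset X Y) i (p @ q)"
    using a assms unfolding has_def prodset_def
    by (intro bexI[of _ "a @ b"]) (auto simp: vle_append nth_append)
qed

lemma has_append_right:
  assumes "good_axioms d X" "good_axioms d' Y" "length p = d" "length q = d'" "i < d'"
  shows "has (prodset X Y) (d + i) (p @ q) \<longleftrightarrow> has Y i q"
proof
  assume "has (prodset X Y) (d + i) (p @ q)"
  then obtain a b where "a \<in> X" "b \<in> Y" "vle (p @ q) (a @ b)"
    "(a @ b) ! (d + i) = (p @ q) ! (d + i)"
    unfolding has_def prodset_def by blast
  moreover from this have "length a = d" using assms good_length by blast
  ultimately show "has Y i q" using assms by (auto simp: has_def vle_append nth_append)
next
  assume "has Y i q"
  then obtain b where b: "b \<in> Y" "vle q b" "b ! i = q ! i" unfolding has_def by blast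
  obtain a where a: "a \<in> X" "vle p a" using good_above[OF assms(1,3,3)] by blast
  moreover have "length a = d" using a assms good_length by blast
  ultimately show "has (prodset X Y) (d + i) (p @ q)"
    using b assms unfolding has_def prodset_def
    by (intro bexI[of _ "a @ b"]) (auto simp: vle_append nth_append)
qed

lemma up_append_left: "i < length p \<Longrightarrow> up i (p @ q) = up i p @ q"
  by (simp add: up_def list_update_append nth_append)

lemma up_append_right: "up (length p + i) (p @ q) = p @ up i q"
  by (simp add: up_def list_update_append nth_append)

lemma prodset_mono: "X \<subseteq> X' \<Longrightarrow> Y \<subseteq> Y' \<Longrightarrow> prodset X Y \<subseteq> prodset X' Y'"
  unfolding prodset_def by blast

section \<open>Additivity of \<open>g\<close> on products\<close>

locale good_pair_prod =
  P1: good_pair d1 S1 E1 + P2: good_pair d2 S2 E2 for d1 d2 S1 S2 E1 E2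
begin

sublocale prod: good_pair "d1 + d2" "prodset S1 S2" "prodset E1 E2"
  by unfold_locales
    (use P1.S P2.S P1.E P2.E P1.sub P2.sub in \<open>simp_all add: good_axioms_prodset prodset_mono\<close>)

lemma inc_append_left:
  assumes "length p = d1" "length q = d2" "i < d1"
  shows "inc (prodset S1 S2) (prodset E1 E2) i (p @ q) = inc S1 E1 i p"
  using has_append_left[OF P1.S P2.S assms] has_append_left[OF P1.E P2.E assms]
  by (simp add: inc_def)

lemma inc_append_right:
  assumes "length p = d1" "length q = d2" "i < d2"
  shows "inc (prodset S1 S2) (prodset E1 E2) (d1 + i) (p @ q) = inc S2 E2 i q"
  using has_append_right[OF P1.S P2.S assms] has_append_right[OF P1.E P2.E assms]
  by (simp add: inc_def)

text \<open>Climb from the origin through the first \<open>d1\<close> coordinates, then through the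
  last \<open>d2\<close>. Each step counts exactly as in its own factor, whatever the other block
  is.\<close>

lemma g_append:
  assumes "length p = d1" "length q = d2"
  shows "prod.g (p @ q) = P1.g p + P2.g q"
proof -
  have zero: "replicate d1 0 @ replicate d2 0 = replicate (d1 + d2) (0::nat)"
    by (simp add: replicate_add)
  have left: "prod.g (p @ replicate d2 0) = P1.g p"
    using vle_replicate_0[OF assms(1)]
  proof (induction rule: climb)
    case base
    then show ?case by (simp add: zero)
  next
    case (step r)
    then obtain i where i: "i < length r" "r ! i < p ! i" using vle_obtain_less by metis
    have "length r = d1" using step assms by (simp add: vle_def)
    then show ?case
      using i step prod.g_up[of "r @ replicate d2 0" i]
      by (intro exI[of _ i]) (simp add: P1.g_up inc_append_left up_append_left)
  qed
  show ?thesis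
    using vle_replicate_0[OF assms(2)]
  proof (induction rule: climb)
    case base
    then show ?case by (simp add: left)
  next
    case (step r)
    then obtain i where i: "i < length r" "r ! i < q ! i" using vle_obtain_less by metis
    have "length r = d2" using step assms by (simp add: vle_def)
    then show ?case
      using i step assms prod.g_up[of "p @ r" "d1 + i"] up_append_right[of p i r]
      by (intro exI[of _ i]) (simp add: P2.g_up inc_append_right)
  qed
qed

end

theorem theorem4p4:
  fixes d1 d2 :: nat and S1 S2 E1 E2 :: "nat list set" and a1 a2 :: "nat list"
  assumes "d1 \<ge> 1" and "d2 \<ge> 1"
    and "good_semigroup d1 S1" and "good_semigroup d2 S2"
    and "good_ideal d1 S1 E1" and "E1 \<noteq> S1"
    and "good_ideal d2 S2 E2" and "E2 \<noteq> S2"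
    and "a1 \<in> S1" and "a2 \<in> S2"
    and "a1 @ a2 \<in> prodset S1 S2 - prodset E1 E2"
  shows "level_of (d1 + d2) (prodset S1 S2 - prodset E1 E2) (a1 @ a2)
         = level_fun d1 (S1 - E1) a1 + level_fun d2 (S2 - E2) a2 - 1"
proof -
  interpret good_pair_prod d1 d2 S1 S2 E1 E2
    by unfold_locales (use assms in \<open>simp_all add: good_semigroup_def good_ideal_def\<close>)
  have "length a1 = d1" "length a2 = d2"
    using assms P1.S P2.S good_length by blast+
  \<comment> \<open>All three levels are \<open>Suc\<close> of a value of \<open>g\<close>;
    subtracting 1 removes the surplus \<open>Suc\<close> on the right.\<close>
  then show ?thesis
    using assms by (simp add: prod.level_of_eq P1.level_fun_eq P2.level_fun_eq g_append)
qed

end
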